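(* Let $q$ be a prime power, $S\subseteq\mathbb{F}_q$, and $\lambda:\mathbb{F}_q\to S$ a surjective map. Let $b\in\mathbb{F}_q$ and let $\gamma\in\mathbb{F}_q^\ast$ be a $b$-linear translator of $\lambda$ with respect to $S$. Let $G\in\mathbb{F}_q[x]$ be a polynomial which maps $S$ into $S$. Suppose $f(x)=x+\gamma G(\lambda(x))$ is a permutation of $\mathbb{F}_q$ (so that $g(x)=x+bG(x)$ permutes $S$), and let $g^{-1}$ be the compositional inverse of $g$ on $S$. Then the compositional inverse of $f$ on $\mathbb{F}_q$ is given by $$f^{-1}(x)=x-\gamma G(g^{-1}(\lambda(x))).$$
   Context: $\mathbb{F}_q$ is the finite field with $q$ elements. For $S\subseteq\mathbb{F}_q$, $\gamma,b\in\mathbb{F}_q$ and a map $\lambda:\mathbb{F}_q\to\mathbb{F}_q$, $\gamma$ is called a $b$-linear translator of $\lambda$ with respect to $S$ if $\lambda(x+u\gamma)=\lambda(x)+ub$ for all $x\in\mathbb{F}_q$ and $u\in S$. It is known (Akbary–Ghioca–Wang) that under these hypotheses $f$ permutes $\mathbb{F}_q$ if and only if $g$ permutes $S$. *)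

theory Defs
  imports "HOL-Computational_Algebra.Polynomial"
begin

definition linear_translator :: "'a::field \<Rightarrow> 'a \<Rightarrow> ('a \<Rightarrow> 'a) \<Rightarrow> 'a set \<Rightarrow> bool" where
  "linear_translator b \<gamma> lam S \<longleftrightarrow> (\<forall>x. \<forall>u\<in>S. lam (x + u * \<gamma>) = lam x + u * b)"

end

theory Submission
  imports Defs
begin

text \<open>The translator property gives the semiconjugacy \<open>lam \<circ> f = g \<circ> lam\<close>. As \<open>f\<close> and \<open>lam\<close> are
  surjective, \<open>g\<close> maps \<open>S\<close> onto itself, hence permutes the finite set \<open>S\<close>. If \<open>f y = x\<close>, then
  \<open>lam x = g (lam y)\<close>, so \<open>lam y\<close> is determined by \<open>x\<close> and \<open>y = x - \<gamma> G(lam y)\<close>.\<close>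

theorem corollary3p4:
  fixes S :: "'a::{field,finite} set"
    and lam f g :: "'a \<Rightarrow> 'a"
    and b \<gamma> :: 'a
    and G :: "'a poly"
  assumes "range lam = S"
    and "\<gamma> \<noteq> 0"
    and "linear_translator b \<gamma> lam S"
    and "poly G ` S \<subseteq> S"
    and "f = (\<lambda>x. x + \<gamma> * poly G (lam x))"
    and "g = (\<lambda>x. x + b * poly G x)"
    and "bij f"
  shows "bij_betw g S S \<and> (\<forall>x. inv f x = x - \<gamma> * poly G (inv_into S g (lam x)))"
proof -
  have semiconj: "lam (f x) = g (lam x)" for x
  proof -
    \<comment> \<open>The translator identity covers only scalars from \<open>S\<close>; this admits
      \<open>u = poly G (lam x)\<close>.\<close>
    have "poly G (lam x) \<in> S"
      using assms(1,4) by blast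
    then have "lam (x + poly G (lam x) * \<gamma>) = lam x + poly G (lam x) * b"
      using assms(3) unfolding linear_translator_def by blast
    then show ?thesis
      by (simp add: assms(5,6) mult.commute)
  qed
  have "g ` S = range (\<lambda>x. lam (f x))"
    by (simp add: semiconj image_image flip: assms(1))
  \<comment> \<open>Precomposing with the surjection \<open>f\<close> leaves the range of
    \<open>lam\<close> unchanged.\<close>
  also have "\<dots> = S"
    using bij_is_surj[OF assms(7)] assms(1) by (metis image_image)
  finally have surj: "g ` S = S" .
  \<comment> \<open>\<open>S\<close> lies in a finite field, so equal cardinality of
    \<open>S\<close> and its image forces injectivity.\<close>
  then have inj: "inj_on g S"
    by (simp add: eq_card_imp_inj_on)
  have "inv f x = x - \<gamma> * poly G (inv_into S g (lam x))" for x
  proof -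
    define y where "y = inv f x"
    have fy: "f y = x"
      unfolding y_def by (rule surj_f_inv_f[OF bij_is_surj[OF assms(7)]])
    have "lam y \<in> S"
      using assms(1) by blast
    \<comment> \<open>Here \<open>lam x = g (lam y)\<close>, and \<open>inv_into S g\<close> cancels
      \<open>g\<close> on \<open>S\<close> by injectivity.\<close>
    then have "inv_into S g (lam x) = lam y"
      using semiconj[of y] inj by (simp add: fy)
    moreover have "y = x - \<gamma> * poly G (lam y)"
      using fy by (simp add: assms(5) eq_diff_eq)
    ultimately show ?thesis
      by (simp flip: y_def)
  qed
  with inj surj show ?thesis
    by (simp add: bij_betw_def)
qed

end
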